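(* Let $\boldsymbol{P}\in\mathbb{R}^{[3,n]}$ be a stochastic tensor and let $\{c_t\}_{t\ge 0}\subset[0,1]$ be a non-increasing sequence such that $$\sum_{t=1}^\infty c_t=+\infty.$$ Consider the process $$x_{t+1}=\boldsymbol{P}x_ty_t,\qquad y_{t+1}=c_tx_t+(1-c_t)y_t,\qquad t=0,1,2,\dots$$ If $\mathcal{T}_L(\boldsymbol{P})+\mathcal{T}_R(\boldsymbol{P})<1$, then this process converges globally, i.e., for any starting points $x_0,y_0\in\mathcal{S}_1$ we have $$\lim_{t\to\infty}\|x_t-x\|_1=\lim_{t\to\infty}\|y_t-x\|_1=0,$$ where $x$ is the unique solution in $\mathcal{S}_1$ of $x=\boldsymbol{P}xx$. Moreover, if there exists a positive constant $\alpha$ such that $c_t\ge\alpha$ for all $t$, then the convergence is linear.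
   Context: $\mathbb{R}^{[3,n]}$ is the set of real $n\times n\times n$ arrays $\boldsymbol{P}=(\boldsymbol{P}_{ijk})$, $n\ge 2$. $\boldsymbol{P}$ is called stochastic if $\boldsymbol{P}_{ijk}\ge 0$ for all $i,j,k$ and $\sum_{i=1}^n\boldsymbol{P}_{ijk}=1$ for all $j,k$. For $x,y\in\mathbb{R}^n$, $(\boldsymbol{P}xy)_i=\sum_{j,k}\boldsymbol{P}_{ijk}x_jy_k$. Let $\mathcal{S}_1=\{x\in\mathbb{R}^n: x\ge 0,\ \|x\|_1=1\}$ and $\mathcal{Z}_1=\{x\in\mathbb{R}^n:\sum_i x_i=0,\ \|x\|_1=1\}$. Definitions: $\mathcal{T}_L(\boldsymbol{P})=\max_{x\in\mathcal{S}_1}\max_{y\in\mathcal{Z}_1}\|\boldsymbol{P}xy\|_1$ and $\mathcal{T}_R(\boldsymbol{P})=\max_{x\in\mathcal{S}_1}\max_{y\in\mathcal{Z}_1}\|\boldsymbol{P}yx\|_1$. "Linear convergence" means that there are constants $C\ge 0$ and $q\in(0,1)$ with $\max\{\|x_t-x\|_1,\|y_t-x\|_1\}\le Cq^t$ for all $t$. *)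

theory Defs
  imports "HOL-Analysis.Analysis"
begin

text \<open>A cubical tensor is a nested vector, so that the entry with indices \<open>i, j, k\<close> is
  \<open>P $ i $ j $ k\<close>; the dimension \<open>n\<close> is the cardinality of the finite index type.\<close>

type_synonym 'n tensor3 = "real ^ 'n ^ 'n ^ 'n"

definition stochastic_tensor :: "'n::finite tensor3 \<Rightarrow> bool" where
  "stochastic_tensor P \<longleftrightarrow>
     (\<forall>i j k. P $ i $ j $ k \<ge> 0) \<and> (\<forall>j k. (\<Sum>i\<in>UNIV. P $ i $ j $ k) = 1)"

definition tapply :: "'n::finite tensor3 \<Rightarrow> real ^ 'n \<Rightarrow> real ^ 'n \<Rightarrow> real ^ 'n" where
  "tapply P x y = (\<chi> i. \<Sum>j\<in>UNIV. \<Sum>k\<in>UNIV. P $ i $ j $ k * x $ j * y $ k)"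

text \<open>The library norm on \<^typ>\<open>real ^ 'n\<close> is the Euclidean one.\<close>

definition norm1 :: "real ^ 'n::finite \<Rightarrow> real" where
  "norm1 x = (\<Sum>i\<in>UNIV. \<bar>x $ i\<bar>)"

definition S1 :: "(real ^ 'n::finite) set" where
  "S1 = {x. (\<forall>i. x $ i \<ge> 0) \<and> norm1 x = 1}"

definition Z1 :: "(real ^ 'n::finite) set" where
  "Z1 = {x. (\<Sum>i\<in>UNIV. x $ i) = 0 \<and> norm1 x = 1}"

text \<open>The maxima are written as suprema, because \<^const>\<open>Max\<close> is only meaningful for finite sets.
  For \<open>n \<ge> 2\<close> they are attained, see \<open>T_L_is_max\<close> and \<open>T_R_is_max\<close> below;
  for \<open>n = 1\<close> the set \<^const>\<open>Z1\<close> is empty.\<close>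

definition T_L :: "'n::finite tensor3 \<Rightarrow> real" where
  "T_L P = (SUP x\<in>S1. SUP y\<in>Z1. norm1 (tapply P x y))"

definition T_R :: "'n::finite tensor3 \<Rightarrow> real" where
  "T_R P = (SUP x\<in>S1. SUP y\<in>Z1. norm1 (tapply P y x))"

definition is_process ::
    "'n::finite tensor3 \<Rightarrow> (nat \<Rightarrow> real) \<Rightarrow> (nat \<Rightarrow> real ^ 'n) \<Rightarrow> (nat \<Rightarrow> real ^ 'n) \<Rightarrow> bool" where
  "is_process P c X Y \<longleftrightarrow>
     (\<forall>t. X (Suc t) = tapply P (X t) (Y t) \<and>
          Y (Suc t) = c t *\<^sub>R X t + (1 - c t) *\<^sub>R Y t)"

definition linear_convergence ::
    "(nat \<Rightarrow> real ^ 'n::finite) \<Rightarrow> (nat \<Rightarrow> real ^ 'n) \<Rightarrow> real ^ 'n \<Rightarrow> bool" where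
  "linear_convergence X Y x \<longleftrightarrow>
     (\<exists>C q. C \<ge> 0 \<and> 0 < q \<and> q < 1 \<and>
        (\<forall>t. max (norm1 (X t - x)) (norm1 (Y t - x)) \<le> C * q ^ t))"


lemma norm_le_norm1: "norm x \<le> norm1 (x :: real ^ 'n::finite)"
  unfolding norm1_def by (rule norm_le_l1_cart)

lemma continuous_on_norm1 [continuous_intros]:
  assumes "continuous_on A f"
  shows "continuous_on A (\<lambda>z. norm1 (f z :: real ^ 'n::finite))"
  unfolding norm1_def by (intro continuous_intros assms)

lemma continuous_on_tapply [continuous_intros]:
  assumes "continuous_on A f" "continuous_on A g"
  shows "continuous_on A (\<lambda>z. tapply P (f z) (g z :: real ^ 'n::finite))"
  unfolding tapply_def by (intro continuous_intros assms)

lemma compact_S1: "compact (S1 :: (real ^ 'n::finite) set)"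
proof -
  have "closed (S1 :: (real ^ 'n) set)"
    unfolding S1_def
    by (intro closed_Collect_conj closed_Collect_all closed_Collect_le closed_Collect_eq
        continuous_intros)
  moreover have "bounded (S1 :: (real ^ 'n) set)"
    unfolding bounded_iff
    by (intro exI[of _ 1] ballI order_trans[OF norm_le_norm1]) (simp add: S1_def)
  ultimately show ?thesis by (simp add: compact_eq_bounded_closed)
qed

lemma compact_Z1: "compact (Z1 :: (real ^ 'n::finite) set)"
proof -
  have "closed (Z1 :: (real ^ 'n) set)"
    unfolding Z1_def by (intro closed_Collect_conj closed_Collect_eq continuous_intros)
  moreover have "bounded (Z1 :: (real ^ 'n) set)"
    unfolding bounded_iff
    by (intro exI[of _ 1] ballI order_trans[OF norm_le_norm1]) (simp add: Z1_def)
  ultimately show ?thesis by (simp add: compact_eq_bounded_closed)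
qed

lemma S1_nonempty: "(S1 :: (real ^ 'n::finite) set) \<noteq> {}"
proof -
  have "axis undefined 1 \<in> (S1 :: (real ^ 'n) set)"
    by (auto simp: S1_def norm1_def axis_def if_distrib[of abs] cong: if_cong)
  then show ?thesis by blast
qed

lemma Z1_nonempty:
  assumes "CARD('n::finite) \<ge> 2"
  shows "(Z1 :: (real ^ 'n) set) \<noteq> {}"
proof -
  obtain a b :: 'n where ab: "a \<noteq> b"
    using assms by (metis UNIV_I card_2_iff' card_le_Suc0_iff_eq finite not_less_eq_eq numeral_2_eq_2)
  let ?x = "(\<chi> i. (if i = a then 1/2 else 0) - (if i = b then 1/2 else 0)) :: real ^ 'n"
  have "(\<Sum>i\<in>UNIV. ?x $ i) = 0" by (simp add: sum_subtractf)
  moreover have "\<bar>?x $ i\<bar> = (if i = a then 1/2 else 0) + (if i = b then 1/2 else 0)" for i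
    using ab by auto
  then have "norm1 ?x = 1" unfolding norm1_def by (simp add: sum.distrib)
  ultimately show ?thesis unfolding Z1_def by blast
qed

lemma SUP_SUP_is_max:
  fixes f :: "'a::topological_space \<times> 'b::topological_space \<Rightarrow> real"
  assumes A: "compact A" "A \<noteq> {}" and B: "compact B" "B \<noteq> {}"
    and f: "continuous_on (A \<times> B) f"
  shows "(\<exists>x\<in>A. \<exists>y\<in>B. f (x, y) = (SUP x\<in>A. SUP y\<in>B. f (x, y))) \<and>
         (\<forall>x\<in>A. \<forall>y\<in>B. f (x, y) \<le> (SUP x\<in>A. SUP y\<in>B. f (x, y)))"
proof -
  obtain p where "p \<in> A \<times> B" "\<forall>z\<in>A \<times> B. f z \<le> f p"
    using continuous_attains_sup[OF compact_Times[OF A(1) B(1)] _ f] A B by blast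
  then obtain a b where ab: "a \<in> A" "b \<in> B" "\<And>x y. x \<in> A \<Longrightarrow> y \<in> B \<Longrightarrow> f (x, y) \<le> f (a, b)"
    by (metis mem_Sigma_iff surj_pair)
  have inner_le: "(SUP y\<in>B. f (x, y)) \<le> f (a, b)" if "x \<in> A" for x
    using that ab B by (intro cSUP_least) auto
  have "f (a, b) \<le> (SUP y\<in>B. f (a, y))"
    using ab by (intro cSUP_upper bdd_aboveI2[of _ _ "f (a, b)"]) auto
  also have "\<dots> \<le> (SUP x\<in>A. SUP y\<in>B. f (x, y))"
    using ab inner_le
    by (intro cSUP_upper[of a A "\<lambda>x. SUP y\<in>B. f (x, y)"] bdd_aboveI2[of _ _ "f (a, b)"]) auto
  finally have "f (a, b) \<le> (SUP x\<in>A. SUP y\<in>B. f (x, y))" .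
  moreover have "(SUP x\<in>A. SUP y\<in>B. f (x, y)) \<le> f (a, b)"
    using A(2) inner_le by (rule cSUP_least)
  ultimately have "f (a, b) = (SUP x\<in>A. SUP y\<in>B. f (x, y))" by linarith
  then show ?thesis using ab by metis
qed

lemma T_L_is_max:
  fixes P :: "'n::finite tensor3"
  assumes "CARD('n) \<ge> 2"
  shows "(\<exists>x\<in>S1. \<exists>y\<in>Z1. norm1 (tapply P x y) = T_L P) \<and>
         (\<forall>x\<in>S1. \<forall>y\<in>Z1. norm1 (tapply P x y) \<le> T_L P)"
  using SUP_SUP_is_max[OF compact_S1 S1_nonempty compact_Z1 Z1_nonempty[OF assms],
      of "\<lambda>z. norm1 (tapply P (fst z) (snd z))"]
  by (simp add: T_L_def continuous_intros)

lemma T_R_is_max: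
  fixes P :: "'n::finite tensor3"
  assumes "CARD('n) \<ge> 2"
  shows "(\<exists>x\<in>S1. \<exists>y\<in>Z1. norm1 (tapply P y x) = T_R P) \<and>
         (\<forall>x\<in>S1. \<forall>y\<in>Z1. norm1 (tapply P y x) \<le> T_R P)"
  using SUP_SUP_is_max[OF compact_S1 S1_nonempty compact_Z1 Z1_nonempty[OF assms],
      of "\<lambda>z. norm1 (tapply P (snd z) (fst z))"]
  by (simp add: T_R_def continuous_intros)

end

theory Submission
  imports Defs
begin

text \<open>Write \<open>a t\<close> and \<open>b t\<close> for the \<open>\<ell>\<^sub>1\<close> distances of \<open>X t\<close> and \<open>Y t\<close> to the fixed point, and
  \<open>L\<close>, \<open>R\<close> for the two ergodicity coefficients. Bilinearity gives
  \<open>a (t + 1) \<le> L * b t + R * a t\<close> and \<open>b (t + 1) \<le> c t * a t + (1 - c t) * b t\<close>. No fixed positive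
  combination of \<open>a\<close> and \<open>b\<close> need decrease when \<open>c t\<close> is small, but the moving weight in
  \<open>V t = k * c t * a t + b t\<close> does the job: since \<open>c\<close> is non-increasing,
  \<open>V (t + 1) \<le> (1 - d * c t) * V t\<close> for \<open>d = (1 - L - R) / 2\<close> and \<open>k = 2 / (1 - R + L)\<close>.
  Divergence of \<open>\<Sum> c t\<close> then forces \<open>V\<close>, hence \<open>b\<close>, hence \<open>a\<close> to vanish. The
  fixed point itself minimises \<open>norm1 (x - tapply P x x)\<close> over the compact simplex.\<close>

section \<open>The l1 norm and bilinearity of the tensor action\<close>

lemma norm1_nonneg [simp]: "norm1 x \<ge> 0"
  unfolding norm1_def by (simp add: sum_nonneg)

lemma norm1_zero [simp]: "norm1 0 = 0"
  unfolding norm1_def by simp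

lemma norm1_eq_0_iff [simp]: "norm1 x = 0 \<longleftrightarrow> x = 0"
  unfolding norm1_def by (simp add: sum_nonneg_eq_0_iff vec_eq_iff)

lemma norm1_triangle: "norm1 (x + y) \<le> norm1 x + norm1 y"
  unfolding norm1_def by (simp flip: sum.distrib add: sum_mono abs_triangle_ineq)

lemma norm1_scaleR: "norm1 (r *\<^sub>R x) = \<bar>r\<bar> * norm1 x"
  unfolding norm1_def by (simp add: abs_mult sum_distrib_left)

lemma tapply_diff_left: "tapply P (x - x') y = tapply P x y - tapply P x' y"
  unfolding tapply_def by (simp add: vec_eq_iff algebra_simps sum_subtractf)

lemma tapply_diff_right: "tapply P x (y - y') = tapply P x y - tapply P x y'"
  unfolding tapply_def by (simp add: vec_eq_iff algebra_simps sum_subtractf)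

lemma tapply_scaleR_left: "tapply P (r *\<^sub>R x) y = r *\<^sub>R tapply P x y"
  unfolding tapply_def by (simp add: vec_eq_iff sum_distrib_left mult_ac)

lemma tapply_scaleR_right: "tapply P x (r *\<^sub>R y) = r *\<^sub>R tapply P x y"
  unfolding tapply_def by (simp add: vec_eq_iff sum_distrib_left mult_ac)

section \<open>The simplex and its invariance\<close>

lemma S1_iff: "x \<in> S1 \<longleftrightarrow> (\<forall>i. x $ i \<ge> 0) \<and> (\<Sum>i\<in>UNIV. x $ i) = 1"
  unfolding S1_def norm1_def by auto

lemma sum_diff_S1:
  assumes "x \<in> S1" "y \<in> S1"
  shows "(\<Sum>i\<in>UNIV. (x - y) $ i) = 0"
  using assms by (simp add: S1_iff sum_subtractf)

lemma tapply_in_S1: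
  assumes "stochastic_tensor P" "x \<in> S1" "y \<in> S1"
  shows "tapply P x y \<in> S1"
proof -
  \<comment> \<open>The sum over \<open>i\<close> is moved innermost, where stochasticity makes it
    1; what remains factors into the two coordinate sums.\<close>
  have "(\<Sum>i\<in>UNIV. tapply P x y $ i)
      = (\<Sum>j\<in>UNIV. \<Sum>i\<in>UNIV. \<Sum>k\<in>UNIV. P $ i $ j $ k * x $ j * y $ k)"
    unfolding tapply_def by (simp, rule sum.swap)
  also have "\<dots> = (\<Sum>j\<in>UNIV. \<Sum>k\<in>UNIV. \<Sum>i\<in>UNIV. P $ i $ j $ k * x $ j * y $ k)"
    by (intro sum.cong refl sum.swap)
  also have "\<dots> = (\<Sum>j\<in>UNIV. \<Sum>k\<in>UNIV. (\<Sum>i\<in>UNIV. P $ i $ j $ k) * (x $ j * y $ k))"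
    by (simp add: sum_distrib_right mult.assoc)
  also have "\<dots> = (\<Sum>j\<in>UNIV. x $ j) * (\<Sum>k\<in>UNIV. y $ k)"
    using assms(1) by (simp add: stochastic_tensor_def sum_product)
  also have "\<dots> = 1" using assms by (simp add: S1_iff)
  finally have "(\<Sum>i\<in>UNIV. tapply P x y $ i) = 1" .
  moreover have "tapply P x y $ i \<ge> 0" for i
    using assms unfolding tapply_def
    by (simp add: S1_iff stochastic_tensor_def sum_nonneg)
  ultimately show ?thesis by (simp add: S1_iff)
qed

lemma convex_combination_in_S1:
  assumes "x \<in> S1" "y \<in> S1" "0 \<le> r" "r \<le> 1"
  shows "r *\<^sub>R x + (1 - r) *\<^sub>R y \<in> S1"
  using assms by (simp add: S1_iff sum.distrib flip: sum_distrib_left)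

section \<open>Contraction bounds from the ergodicity coefficients\<close>

lemma normalized_in_Z1:
  assumes "(\<Sum>i\<in>UNIV. z $ i) = 0" "z \<noteq> 0"
  shows "(1 / norm1 z) *\<^sub>R z \<in> Z1"
  using assms by (simp add: Z1_def norm1_scaleR flip: sum_divide_distrib)

text \<open>Homogeneity carries the bound from the unit vectors in \<open>Z1\<close> to all zero-sum
  vectors; only 0 cannot be normalized and is treated apart.\<close>

lemma norm1_tapply_le_T_L:
  fixes P :: "'n::finite tensor3"
  assumes "CARD('n) \<ge> 2" "x \<in> S1" "(\<Sum>i\<in>UNIV. z $ i) = 0"
  shows "norm1 (tapply P x z) \<le> T_L P * norm1 z"
proof (cases "z = 0")
  case True
  then show ?thesis using tapply_diff_right[of P x 0 0] by simp
next
  case False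
  then have "norm1 z > 0" by (simp add: less_le)
  moreover have "norm1 (tapply P x ((1 / norm1 z) *\<^sub>R z)) \<le> T_L P"
    using T_L_is_max[OF assms(1)] assms(2) normalized_in_Z1[OF assms(3) False] by blast
  ultimately show ?thesis
    by (simp add: tapply_scaleR_right norm1_scaleR pos_divide_le_eq)
qed

lemma norm1_tapply_le_T_R:
  fixes P :: "'n::finite tensor3"
  assumes "CARD('n) \<ge> 2" "x \<in> S1" "(\<Sum>i\<in>UNIV. z $ i) = 0"
  shows "norm1 (tapply P z x) \<le> T_R P * norm1 z"
proof (cases "z = 0")
  case True
  then show ?thesis using tapply_diff_left[of P 0 0 x] by simp
next
  case False
  then have "norm1 z > 0" by (simp add: less_le)
  moreover have "norm1 (tapply P ((1 / norm1 z) *\<^sub>R z) x) \<le> T_R P"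
    using T_R_is_max[OF assms(1)] assms(2) normalized_in_Z1[OF assms(3) False] by blast
  ultimately show ?thesis
    by (simp add: tapply_scaleR_left norm1_scaleR pos_divide_le_eq)
qed

lemma T_L_nonneg:
  fixes P :: "'n::finite tensor3"
  assumes "CARD('n) \<ge> 2"
  shows "T_L P \<ge> 0"
  using T_L_is_max[OF assms, of P] norm1_nonneg by metis

lemma T_R_nonneg:
  fixes P :: "'n::finite tensor3"
  assumes "CARD('n) \<ge> 2"
  shows "T_R P \<ge> 0"
  using T_R_is_max[OF assms, of P] norm1_nonneg by metis

text \<open>Inserting \<open>tapply P x y'\<close> changes one argument at a time. The other
  argument stays in the simplex and the increment has sum zero, so each coefficient applies to one
  term.\<close>

lemma norm1_tapply_diff_le:
  fixes P :: "'n::finite tensor3"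
  assumes "CARD('n) \<ge> 2" "x \<in> S1" "y \<in> S1" "x' \<in> S1" "y' \<in> S1"
  shows "norm1 (tapply P x y - tapply P x' y')
           \<le> T_L P * norm1 (y - y') + T_R P * norm1 (x - x')"
proof -
  have "tapply P x y - tapply P x' y' = tapply P x (y - y') + tapply P (x - x') y'"
    by (simp add: tapply_diff_left tapply_diff_right)
  then have "norm1 (tapply P x y - tapply P x' y')
      \<le> norm1 (tapply P x (y - y')) + norm1 (tapply P (x - x') y')"
    by (simp add: norm1_triangle)
  also have "\<dots> \<le> T_L P * norm1 (y - y') + T_R P * norm1 (x - x')"
    using assms by (intro add_mono norm1_tapply_le_T_L norm1_tapply_le_T_R sum_diff_S1)
  finally show ?thesis .
qed

section \<open>Fixed points in the simplex\<close>

lemma stochastic_tensor_fixed_point_unique: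
  fixes P :: "'n::finite tensor3"
  assumes "CARD('n) \<ge> 2" "T_L P + T_R P < 1"
    and "x \<in> S1" "x = tapply P x x" "z \<in> S1" "z = tapply P z z"
  shows "z = x"
proof (rule ccontr)
  assume "z \<noteq> x"
  then have "norm1 (z - x) > 0" by (simp add: less_le)
  moreover have "norm1 (z - x) \<le> (T_L P + T_R P) * norm1 (z - x)"
    using norm1_tapply_diff_le[OF assms(1,5,5,3,3), of P] assms(4,6)
    by (simp add: distrib_right)
  ultimately show False using assms(2) by simp
qed

lemma stochastic_tensor_fixed_point_exists:
  fixes P :: "'n::finite tensor3"
  assumes "CARD('n) \<ge> 2" "stochastic_tensor P" "T_L P + T_R P < 1"
  shows "\<exists>x\<in>S1. x = tapply P x x"
proof -
  obtain x where x: "x \<in> S1"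
    and min: "\<And>z. z \<in> S1 \<Longrightarrow> norm1 (x - tapply P x x) \<le> norm1 (z - tapply P z z)"
    using continuous_attains_inf[OF compact_S1 S1_nonempty, of "\<lambda>x. norm1 (x - tapply P x x)"]
    by (force intro: continuous_intros)
  let ?z = "tapply P x x"
  have z: "?z \<in> S1" using tapply_in_S1[OF assms(2) x x] .
  \<comment> \<open>By minimality the residual at \<open>?z\<close> is no smaller than at
    \<open>x\<close>, while one more application of the map multiplies it by at most
    \<open>T_L P + T_R P\<close>. Since this factor is below 1, the residual vanishes.\<close>
  have "norm1 (x - ?z) \<le> (T_L P + T_R P) * norm1 (x - ?z)"
    using min[OF z] norm1_tapply_diff_le[OF assms(1) x x z z, of P] by (simp add: distrib_right)
  then have "norm1 (x - ?z) \<le> 0"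
    using assms(3) by (smt (verit, best) mult_less_cancel_right2 norm1_nonneg)
  then have "norm1 (x - ?z) = 0"
    using norm1_nonneg[of "x - ?z"] by linarith
  then show ?thesis using x by auto
qed

lemma is_process_in_S1:
  assumes "stochastic_tensor P" "\<And>t. c t \<in> {0..1}" "is_process P c X Y" "X 0 \<in> S1" "Y 0 \<in> S1"
  shows "X t \<in> S1 \<and> Y t \<in> S1"
proof (induction t)
  case (Suc t)
  then show ?case
    using assms(1-3) by (simp add: is_process_def tapply_in_S1 convex_combination_in_S1)
qed (use assms in auto)

section \<open>Scalar recursions\<close>

lemma perturbed_contraction_tendsto_0:
  fixes a e :: "nat \<Rightarrow> real"
  assumes "\<And>t. 0 \<le> a t" "0 \<le> r" "r < 1" "e \<longlonglongrightarrow> 0"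
    and step: "\<And>t. a (Suc t) \<le> r * a t + e t"
  shows "a \<longlonglongrightarrow> 0"
proof (rule order_tendstoI)
  fix l :: real assume "l < 0"
  then show "\<forall>\<^sub>F t in sequentially. l < a t"
    by (intro always_eventually allI less_le_trans[OF _ assms(1)])
next
  fix u :: real assume "0 < u"
  \<comment> \<open>Once \<open>e t\<close> is below \<open>(1 - r) * v\<close>, the recursion is
    dominated by an affine contraction with fixed point \<open>v\<close>. Half of \<open>u\<close>
    leaves room for the geometric remainder \<open>r ^ t * a N\<close>.\<close>
  define v where "v = u / 2"
  have "0 < (1 - r) * v" using \<open>0 < u\<close> assms by (simp add: v_def)
  then have "\<forall>\<^sub>F t in sequentially. e t < (1 - r) * v"
    using assms(4) by (rule order_tendstoD(2)[rotated])
  then obtain N where N: "\<And>t. t \<ge> N \<Longrightarrow> e t < (1 - r) * v"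
    by (auto simp: eventually_sequentially)
  have decay: "a (t + N) \<le> v + r ^ t * a N" for t
  proof (induction t)
    case 0
    then show ?case using \<open>0 < u\<close> by (simp add: v_def)
  next
    case (Suc t)
    have "a (Suc t + N) \<le> r * a (t + N) + (1 - r) * v"
      using step[of "t + N"] N[of "t + N"] by simp
    also have "\<dots> \<le> r * (v + r ^ t * a N) + (1 - r) * v"
      using Suc assms(2) by (simp add: mult_left_mono)
    also have "\<dots> = v + r ^ Suc t * a N" by (simp add: algebra_simps)
    finally show ?case .
  qed
  have "(\<lambda>t. v + r ^ t * a N) \<longlonglongrightarrow> v + 0 * a N"
    using assms by (intro tendsto_intros LIMSEQ_power_zero) auto
  then have "\<forall>\<^sub>F t in sequentially. v + r ^ t * a N < u"
    by (rule order_tendstoD(2)) (use \<open>0 < u\<close> in \<open>simp add: v_def\<close>)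
  then have "\<forall>\<^sub>F t in sequentially. a (t + N) < u"
    by eventually_elim (rule le_less_trans[OF decay])
  then show "\<forall>\<^sub>F t in sequentially. a t < u"
    by (rule eventually_sequentially_seg[THEN iffD1])
qed

text \<open>By \<open>1 - s \<le> exp (- s)\<close> the accumulated factors are at most the
  exponential of minus \<open>d\<close> times a divergent sum. The factors may be negative, because
  this inequality holds for all real \<open>s\<close> and \<open>V\<close> is nonnegative.\<close>

lemma decay_tendsto_0:
  fixes V c :: "nat \<Rightarrow> real"
  assumes V: "\<And>t. 0 \<le> V t" and d: "0 < d"
    and step: "\<And>t. V (Suc t) \<le> (1 - d * c t) * V t"
    and div: "filterlim (\<lambda>N. \<Sum>t=1..N. c t) at_top sequentially"
  shows "V \<longlonglongrightarrow> 0"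
proof -
  \<comment> \<open>The sums in \<open>div\<close> start at index 1, so the recursion is unrolled
    from \<open>V 1\<close>.\<close>
  have V1: "V (Suc N) \<le> V 1 * exp (- (d * (\<Sum>t=1..N. c t)))" for N
  proof (induction N)
    case (Suc N)
    have "1 - d * c (Suc N) \<le> exp (- (d * c (Suc N)))"
      using exp_ge_add_one_self[of "- (d * c (Suc N))"] by simp
    then have "V (Suc (Suc N)) \<le> exp (- (d * c (Suc N))) * V (Suc N)"
      using step V by (meson mult_right_mono order_trans)
    also have "\<dots> \<le> exp (- (d * c (Suc N))) * (V 1 * exp (- (d * (\<Sum>t=1..N. c t))))"
      using Suc by simp
    also have "\<dots> = V 1 * exp (- (d * (\<Sum>t=1..Suc N. c t)))"
      by (simp add: algebra_simps flip: exp_add)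
    finally show ?case .
  qed simp
  have "filterlim (\<lambda>N. d * (\<Sum>t=1..N. c t)) at_top sequentially"
    by (rule filterlim_tendsto_pos_mult_at_top[OF tendsto_const d div])
  then have "(\<lambda>N. exp (- (d * (\<Sum>t=1..N. c t)))) \<longlonglongrightarrow> 0"
    by (intro filterlim_compose[OF exp_at_bot] filterlim_compose[OF filterlim_uminus_at_bot_at_top])
  then have "(\<lambda>N. V 1 * exp (- (d * (\<Sum>t=1..N. c t)))) \<longlonglongrightarrow> 0"
    by (rule tendsto_mult_right_zero)
  then have "(\<lambda>N. V (Suc N)) \<longlonglongrightarrow> 0"
    by (rule tendsto_sandwich[OF always_eventually always_eventually tendsto_const, rotated 2])
      (use V V1 in auto)
  then show ?thesis by (simp add: filterlim_sequentially_Suc)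
qed

text \<open>Primes mark the values at the next time. The constants balance two coefficients:
  \<open>k = 1 / (1 - R - d)\<close> settles that of \<open>a\<close>, and that of \<open>b\<close>
  then needs \<open>k * L \<le> 1 - d\<close>, which holds for \<open>d\<close> half of the gap
  \<open>1 - L - R\<close>.\<close>

lemma lyapunov_step:
  fixes a b L R d k c c' :: real
  assumes "0 \<le> L" "0 \<le> R" "L + R < 1" "0 \<le> a" "0 \<le> b" "0 \<le> c'" "c' \<le> c" "c \<le> 1"
    and d: "d = (1 - L - R) / 2" and k: "k = 2 / (1 - R + L)"
    and a': "0 \<le> a'" "a' \<le> L * b + R * a" and b': "b' \<le> c * a + (1 - c) * b"
  shows "k * c' * a' + b' \<le> (1 - d * c) * (k * c * a + b)"
proof -
  have kpos: "0 < k" using assms by simp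
  have "1 - R - d = (1 - R + L) / 2" using d by (simp add: field_simps)
  then have kd: "k * (1 - R - d) = 1" using assms by simp
  have kL: "k * L \<le> 1 - d"
  proof -
    have "L \<le> (1 - d) * (1 - R - d)"
    proof -
      have "d * (1 - R - d) \<le> d * 1" using assms by (intro mult_left_mono) auto
      moreover have "L = (1 - R - d) - d" using d by (simp add: field_simps)
      ultimately show ?thesis by (simp only: left_diff_distrib mult_1_left mult_1_right diff_left_mono)
    qed
    then have "k * L \<le> k * ((1 - d) * (1 - R - d))" using kpos by simp
    also have "\<dots> = 1 - d" using kd by (simp add: mult.left_commute)
    finally show ?thesis .
  qed
  \<comment> \<open>Monotonicity of the weights enters here: \<open>c' \<le> c\<close> lets the new
    weight be replaced by the old one, so that \<open>c\<close> factors out of the coefficient of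
    \<open>a\<close>.\<close>
  have "k * c' * a' + b' \<le> k * c * (L * b + R * a) + (c * a + (1 - c) * b)"
    using assms kpos by (intro add_mono mult_mono) auto
  also have "\<dots> = c * (k * R + 1) * a + (1 - c * (1 - k * L)) * b"
    by (simp add: algebra_simps)
  also have "\<dots> \<le> c * (k * (1 - d * c)) * a + (1 - d * c) * b"
  proof (intro add_mono mult_right_mono mult_left_mono)
    \<comment> \<open>The choice of \<open>k\<close> gives \<open>k * R + 1 = k * (1 - d)\<close>,
      and \<open>c \<le> 1\<close> finishes the comparison.\<close>
    have "k * d * c \<le> k * d * 1" using assms kpos by (intro mult_left_mono) auto
    then show "k * R + 1 \<le> k * (1 - d * c)" using kd by (simp add: algebra_simps)
    have "c * d \<le> c * (1 - k * L)" using assms kL by (intro mult_left_mono) auto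
    then show "1 - c * (1 - k * L) \<le> 1 - d * c" by (simp add: mult.commute)
  qed (use assms in auto)
  also have "\<dots> = (1 - d * c) * (k * c * a + b)" by (simp add: algebra_simps)
  finally show ?thesis .
qed

section \<open>Convergence of the process and its rate\<close>

theorem theorem6p5:
  fixes P :: "'n::finite tensor3" and c :: "nat \<Rightarrow> real"
  assumes "CARD('n) \<ge> 2"
    and "stochastic_tensor P"
    and "\<And>t. c t \<in> {0..1}"
    and "decseq c"
    and "filterlim (\<lambda>N. \<Sum>t=1..N. c t) at_top sequentially"
    and "T_L P + T_R P < 1"
  shows "\<exists>x\<in>S1. x = tapply P x x \<and>
           (\<forall>z\<in>S1. z = tapply P z z \<longrightarrow> z = x) \<and>
           (\<forall>X Y. X 0 \<in> S1 \<longrightarrow> Y 0 \<in> S1 \<longrightarrow> is_process P c X Y \<longrightarrow>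
              (\<lambda>t. norm1 (X t - x)) \<longlonglongrightarrow> 0 \<and> (\<lambda>t. norm1 (Y t - x)) \<longlonglongrightarrow> 0 \<and>
              ((\<exists>\<alpha>>0. \<forall>t. c t \<ge> \<alpha>) \<longrightarrow> linear_convergence X Y x))"
proof -
  define L R where "L = T_L P" and "R = T_R P"
  have L: "0 \<le> L" and R: "0 \<le> R" and LR: "L + R < 1"
    using T_L_nonneg[OF assms(1)] T_R_nonneg[OF assms(1)] assms(6) by (auto simp: L_def R_def)
  define d k where "d = (1 - L - R) / 2" and "k = 2 / (1 - R + L)"
  have d: "0 < d" "d < 1" and k: "0 < k" using L R LR by (auto simp: d_def k_def)
  have c: "0 \<le> c t" "c t \<le> 1" for t using assms(3)[of t] by auto
  obtain x where x: "x \<in> S1" "x = tapply P x x"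
    using stochastic_tensor_fixed_point_exists[OF assms(1,2,6)] by blast
  have "(\<lambda>t. norm1 (X t - x)) \<longlonglongrightarrow> 0 \<and> (\<lambda>t. norm1 (Y t - x)) \<longlonglongrightarrow> 0 \<and>
      ((\<exists>\<alpha>>0. \<forall>t. c t \<ge> \<alpha>) \<longrightarrow> linear_convergence X Y x)"
    if "X 0 \<in> S1" "Y 0 \<in> S1" and XY: "is_process P c X Y" for X Y
  proof (intro conjI impI)
    have S1: "X t \<in> S1" "Y t \<in> S1" for t
      using is_process_in_S1[OF assms(2,3) XY that(1,2)] by auto
    define a b V where "a t = norm1 (X t - x)" and "b t = norm1 (Y t - x)"
      and "V t = k * c t * a t + b t" for t
    have nonneg: "0 \<le> a t" "0 \<le> b t" "0 \<le> V t" for t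
      using c k by (simp_all add: a_def b_def V_def)
    have a_step: "a (Suc t) \<le> L * b t + R * a t" for t
      using norm1_tapply_diff_le[OF assms(1) S1 x(1) x(1), of P] XY x(2)
      by (simp add: a_def b_def L_def R_def is_process_def)
    have b_step: "b (Suc t) \<le> c t * a t + (1 - c t) * b t" for t
    proof -
      have "Y (Suc t) - x = c t *\<^sub>R (X t - x) + (1 - c t) *\<^sub>R (Y t - x)"
        using XY by (simp add: is_process_def algebra_simps)
      then have "b (Suc t) \<le> norm1 (c t *\<^sub>R (X t - x)) + norm1 ((1 - c t) *\<^sub>R (Y t - x))"
        unfolding b_def by (simp only: norm1_triangle)
      then show ?thesis using c by (simp add: norm1_scaleR a_def b_def)
    qed
    have V_step: "V (Suc t) \<le> (1 - d * c t) * V t" for t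
      unfolding V_def using L R LR nonneg c decseq_SucD[OF assms(4)] a_step b_step
      by (intro lyapunov_step[OF _ _ _ _ _ _ _ _ d_def k_def])
    have "V \<longlonglongrightarrow> 0" using nonneg(3) d(1) V_step assms(5) by (rule decay_tendsto_0)
    then have b_lim: "b \<longlonglongrightarrow> 0"
      by (rule tendsto_sandwich[OF always_eventually always_eventually tendsto_const, rotated 2])
        (use nonneg c k in \<open>auto simp: V_def\<close>)
    \<comment> \<open>\<open>V\<close> gives no control of \<open>a\<close> when its weight
      \<open>k * c t\<close> tends to 0. Instead \<open>a\<close> obeys a contraction with factor
      \<open>R < 1\<close> perturbed by \<open>L * b t\<close>.\<close>
    have "(\<lambda>t. L * b t) \<longlonglongrightarrow> 0" using b_lim by (rule tendsto_mult_right_zero)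
    then have "a \<longlonglongrightarrow> 0"
      using a_step R L LR nonneg
      by (intro perturbed_contraction_tendsto_0[of a R "\<lambda>t. L * b t"]) (auto simp: add.commute)
    then show "(\<lambda>t. norm1 (X t - x)) \<longlonglongrightarrow> 0" by (simp add: a_def[abs_def])
    show "(\<lambda>t. norm1 (Y t - x)) \<longlonglongrightarrow> 0" using b_lim by (simp add: b_def[abs_def])
    assume "\<exists>\<alpha>>0. \<forall>t. c t \<ge> \<alpha>"
    then obtain \<alpha> where \<alpha>: "0 < \<alpha>" "\<And>t. \<alpha> \<le> c t" by blast
    \<comment> \<open>The lower bound on \<open>c t\<close> makes every factor
      \<open>1 - d * c t\<close> at most \<open>q\<close>; positivity of \<open>q\<close> comes from
      \<open>d < 1\<close> and \<open>\<alpha> \<le> 1\<close>.\<close>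
    define q where "q = 1 - d * \<alpha>"
    have "\<alpha> \<le> 1" using \<alpha>(2) c(2) order_trans by blast
    then have "d * \<alpha> \<le> d * 1" using d by (intro mult_left_mono) auto
    then have q: "0 < q" "q < 1"
      unfolding q_def using d \<alpha>(1) mult_pos_pos[of d \<alpha>] by linarith+
    have V_geometric: "V t \<le> V 0 * q ^ t" for t
    proof (induction t)
      case (Suc t)
      have "1 - d * c t \<le> q" using d \<alpha>(2) by (simp add: q_def)
      then have "V (Suc t) \<le> q * V t"
        using V_step nonneg(3) by (meson mult_right_mono order_trans)
      also have "\<dots> \<le> q * (V 0 * q ^ t)" using Suc q by simp
      finally show ?case by (simp add: mult_ac)
    qed simp
    \<comment> \<open>The weight of \<open>a\<close> in \<open>V\<close> is now at least
      \<open>k * \<alpha>\<close>, so \<open>a t \<le> V t / (k * \<alpha>)\<close>, while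
      \<open>b t \<le> V t\<close>; the maximum covers both.\<close>
    define C where "C = V 0 * max 1 (1 / (k * \<alpha>))"
    have "a t \<le> C * q ^ t \<and> b t \<le> C * q ^ t" for t
    proof -
      have "k * \<alpha> * a t \<le> k * c t * a t"
        using k \<alpha>(2) nonneg(1) by (intro mult_right_mono mult_left_mono) auto
      then have "k * \<alpha> * a t \<le> V t" using nonneg(2)[of t] by (simp add: V_def)
      then have "a t \<le> V t * (1 / (k * \<alpha>))" using k \<alpha>(1) by (simp add: field_simps)
      moreover have "b t \<le> V t * 1" using nonneg(1)[of t] c[of t] k by (simp add: V_def)
      moreover have "V t * m \<le> C * q ^ t" if "0 \<le> m" "m \<le> max 1 (1 / (k * \<alpha>))" for m
      proof -
        have "V t * m \<le> V 0 * q ^ t * max 1 (1 / (k * \<alpha>))"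
          using V_geometric that nonneg(3) q by (intro mult_mono) auto
        then show ?thesis by (simp add: C_def mult_ac)
      qed
      ultimately show ?thesis using k \<alpha>(1)
        by (meson divide_nonneg_pos max.cobounded1 max.cobounded2 mult_pos_pos order_trans zero_le_one)
    qed
    moreover have "0 \<le> C" using nonneg(3) by (simp add: C_def)
    ultimately show "linear_convergence X Y x"
      unfolding linear_convergence_def using q by (auto simp: a_def b_def)
  qed
  then show ?thesis
    using x stochastic_tensor_fixed_point_unique[OF assms(1,6) x] by blast
qed

end
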